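(* We have $$\frac{(1-t)\exp_{q}(x)}{1-t\,\mathrm{Exp}_{q}(yx)\exp_{q}(x)}=\sum_{n=0}^{\infty}\left(\frac{1+yt}{1-t}\right)^{n}P_{n}^{(\mathrm{inv},\mathrm{lpk},\mathrm{des})}\left(q,\frac{(1+y)^{2}t}{(y+t)(1+yt)},\frac{y+t}{1+yt}\right)\frac{x^{n}}{[n]_{q}!}.$$ Equivalently, $$\sum_{n=0}^{\infty}P_{n}^{(\mathrm{inv},\mathrm{lpk},\mathrm{des})}(q,y,t)\frac{x^{n}}{[n]_{q}!}=\frac{(1-v)\exp_{q}\left(\frac{1-v}{1+uv}x\right)}{1-v\,\mathrm{Exp}_{q}\left(\frac{u(1-v)}{1+uv}x\right)\exp_{q}\left(\frac{1-v}{1+uv}x\right)},$$ where $$u=\frac{1+t^{2}-2yt-(1-t)\sqrt{(1+t)^{2}-4yt}}{2(1-y)t},\qquad v=\frac{(1+t)^{2}-2yt-(1+t)\sqrt{(1+t)^{2}-4yt}}{2yt}.$$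
   Context: $\mathfrak{S}_n$ is the set of permutations $\pi=\pi_1\cdots\pi_n$ of $[n]=\{1,\dots,n\}$. For $\pi\in\mathfrak{S}_n$: $\mathrm{des}(\pi)$ is the number of $i\in[n-1]$ with $\pi_i>\pi_{i+1}$; $\mathrm{lpk}(\pi)$ is the number of left peaks, where $i\in[n-1]$ is a left peak if either $2\le i\le n-1$ and $\pi_{i-1}<\pi_i>\pi_{i+1}$, or $i=1$ and $\pi_1>\pi_2$; $\mathrm{inv}(\pi)$ is the number of pairs $(i,j)$ with $1\le i<j\le n$ and $\pi_i>\pi_j$. For $n\ge1$, $P_n^{(\mathrm{inv},\mathrm{lpk},\mathrm{des})}(q,y,t)=\sum_{\pi\in\mathfrak{S}_n}q^{\mathrm{inv}(\pi)}y^{\mathrm{lpk}(\pi)}t^{\mathrm{des}(\pi)}$, and the $0$th polynomial is $1$. Also $[n]_q!=(1+q)(1+q+q^2)\cdots(1+q+\cdots+q^{n-1})$ (with $[0]_q!=[1]_q!=1$), $\exp_q(x)=\sum_{n\ge0}\frac{x^n}{[n]_q!}$ and $\mathrm{Exp}_q(x)=\sum_{n\ge0}q^{\binom n2}\frac{x^n}{[n]_q!}$. Here $q,y,t,x$ are indeterminates and the identities are identities of formal power series in $x$: in the first, coefficients are rational functions of $q,y,t$; in the second, coefficients are formal power series in $t$ over $\mathbb{Q}(q)[y]$, where $\sqrt{(1+t)^2-4yt}$ is the power series in $t$ over $\mathbb{Q}[y]$ with constant term $1$, so that $u,v$ are formal power series in $t$ over $\mathbb{Q}[y]$. *)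

theory Defs
  imports
    "HOL-Computational_Algebra.Computational_Algebra"
    "HOL-Combinatorics.Permutations"
begin

section \<open>Permutation statistics\<close>

text \<open>
  A permutation of $[n]$ is a function \<open>\<pi> :: nat \<Rightarrow> nat\<close> with \<open>\<pi> permutes {1..n}\<close>; it is the
  identity outside \<open>{1..n}\<close>, so values there must not enter the statistics.  In particular
  the condition \<open>2 \<le> i\<close> below keeps \<open>\<pi> 0\<close> from being compared with \<open>\<pi> 1\<close>.
\<close>

definition des :: "nat \<Rightarrow> (nat \<Rightarrow> nat) \<Rightarrow> nat" where
  "des n \<pi> = card {i \<in> {1..n-1}. \<pi> i > \<pi> (i+1)}"

definition lpk :: "nat \<Rightarrow> (nat \<Rightarrow> nat) \<Rightarrow> nat" where
  "lpk n \<pi> = card {i \<in> {1..n-1}.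
     (2 \<le> i \<and> \<pi> (i-1) < \<pi> i \<and> \<pi> i > \<pi> (i+1)) \<or> (i = 1 \<and> \<pi> 1 > \<pi> 2)}"

definition inv_num :: "nat \<Rightarrow> (nat \<Rightarrow> nat) \<Rightarrow> nat" where
  "inv_num n \<pi> = card {(i, j). 1 \<le> i \<and> i < j \<and> j \<le> n \<and> \<pi> i > \<pi> j}"

text \<open>
  The polynomial $P_n^{(\mathrm{inv},\mathrm{lpk},\mathrm{des})}$, evaluated at elements of an
  arbitrary commutative ring.
\<close>

definition P_inv_lpk_des :: "nat \<Rightarrow> 'a \<Rightarrow> 'a \<Rightarrow> 'a \<Rightarrow> 'a::comm_ring_1" where
  "P_inv_lpk_des n q y t =
     (\<Sum>\<pi> | \<pi> permutes {1..n}. q ^ inv_num n \<pi> * y ^ lpk n \<pi> * t ^ des n \<pi>)"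

lemma P_inv_lpk_des_0: "P_inv_lpk_des 0 q y t = 1"
proof -
  have "inv_num 0 \<pi> = 0" for \<pi>
    by (auto simp: inv_num_def card_eq_0_iff)
  thus ?thesis by (simp add: P_inv_lpk_des_def lpk_def des_def)
qed


section \<open>The \<open>q\<close>-exponential series\<close>

definition qfact :: "'a \<Rightarrow> nat \<Rightarrow> 'a::comm_ring_1" where
  "qfact q n = (\<Prod>k=1..n. \<Sum>i<k. q ^ i)"

text \<open>
  The coefficient ring is not required to be a field, because below it is also instantiated with a
  ring of power series in $t$, where \<open>/\<close> is the division of formal power series.
\<close>

definition exp_q :: "'a \<Rightarrow> 'a::{comm_ring_1,inverse} fps" where
  "exp_q q = Abs_fps (\<lambda>n. 1 / qfact q n)"

definition Exp_q :: "'a \<Rightarrow> 'a::{comm_ring_1,inverse} fps" where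
  "Exp_q q = Abs_fps (\<lambda>n. q ^ (n choose 2) / qfact q n)"

text \<open>Substitution of $cx$ for $x$.\<close>

definition at_cx :: "'a fps \<Rightarrow> 'a \<Rightarrow> 'a::comm_ring_1 fps" where
  "at_cx f c = f oo (fps_const c * fps_X)"


section \<open>Coefficient rings and indeterminates\<close>

text \<open>
  The rational function field $\mathbb{Q}(q,y,t)$ is built as $\mathbb{Q}(q)(y)(t)$.
\<close>

type_synonym Qq = "rat poly fract"
type_synonym Qqy = "Qq poly fract"
type_synonym Qqyt = "Qqy poly fract"

definition indet_q :: Qq where "indet_q = to_fract [:0, 1:]"
definition indet_y :: Qqy where "indet_y = to_fract [:0, 1:]"

definition qF :: Qqyt where "qF = to_fract [: to_fract [: indet_q :] :]"
definition yF :: Qqyt where "yF = to_fract [: indet_y :]"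
definition tF :: Qqyt where "tF = to_fract [:0, 1:]"

text \<open>
  The same three indeterminates as elements of the ring of formal power series in $t$.
  The coefficients in $\mathbb{Q}(q)[y]$ are viewed inside the field $\mathbb{Q}(q)(y)$, over which
  division of power series is available.
\<close>

definition qS :: "Qqy fps" where "qS = fps_const (to_fract [: indet_q :])"
definition yS :: "Qqy fps" where "yS = fps_const indet_y"
definition tS :: "Qqy fps" where "tS = fps_X"


section \<open>The series \<open>u\<close> and \<open>v\<close>\<close>

definition sqrtS :: "Qqy fps" where
  "sqrtS = (THE s. fps_nth s 0 = 1 \<and> s ^ 2 = (1 + tS) ^ 2 - 4 * yS * tS)"

definition uS :: "Qqy fps" where
  "uS = (1 + tS ^ 2 - 2 * yS * tS - (1 - tS) * sqrtS) / (2 * (1 - yS) * tS)"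

definition vS :: "Qqy fps" where
  "vS = ((1 + tS) ^ 2 - 2 * yS * tS - (1 + tS) * sqrtS) / (2 * yS * tS)"

text \<open>
  Division of formal power series rounds when the quotient is not a power series.  The
  lemmas below show that the two quotients are exact, that the square root exists
  uniquely, and that \<open>uS\<close> and \<open>vS\<close> have their coefficients in $\mathbb{Q}[y]$.
\<close>

lemma ex1_sqrtS:
  "\<exists>!s :: Qqy fps. fps_nth s 0 = 1 \<and> s ^ 2 = (1 + tS) ^ 2 - 4 * yS * tS"
proof -
  let ?D = "(1 + tS) ^ 2 - 4 * yS * tS :: Qqy fps"
  have D0: "fps_nth ?D 0 = 1"
    by (simp add: tS_def yS_def power2_eq_square)
  let ?s = "fps_radical (\<lambda>_ _. 1) 2 ?D"
  have s: "fps_nth ?s 0 = 1" "?s ^ 2 = ?D"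
    using power_radical[of ?D "\<lambda>_ _. 1" 1] D0 by (simp_all add: numeral_2_eq_2)
  show ?thesis
  proof (rule ex1I[of _ ?s])
    show "fps_nth ?s 0 = 1 \<and> ?s ^ 2 = ?D" using s by blast
  next
    fix r :: "Qqy fps"
    assume r: "fps_nth r 0 = 1 \<and> r ^ 2 = ?D"
    have "r ^ 2 = ?s ^ 2" using r s(2) by simp
    hence "(r - ?s) * (r + ?s) = 0" by (simp add: algebra_simps power2_eq_square)
    moreover have "fps_nth (r + ?s) 0 \<noteq> 0" using r s by simp
    hence "r + ?s \<noteq> 0" by (metis fps_zero_nth)
    ultimately show "r = ?s" by simp
  qed
qed

lemma sqrtS: "fps_nth sqrtS 0 = 1" "sqrtS ^ 2 = (1 + tS) ^ 2 - 4 * yS * tS"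
  using theI'[OF ex1_sqrtS] unfolding sqrtS_def by blast+

lemma indet_y_neq: "indet_y \<noteq> 0" "indet_y \<noteq> 1"
  by (simp_all add: indet_y_def one_pCons flip: to_fract_1 del: to_fract_1)

lemma exact_quotient:
  fixes A B C W r :: "Qqy fps"
  assumes "A ^ 2 - W ^ 2 * r ^ 2 = C ^ 2" "fps_nth A 0 = 1" "fps_nth W 0 = 1" "fps_nth r 0 = 1"
    and "C \<noteq> 0"
  shows "(A - W * r) / C = C * inverse (A + W * r)" "(A - W * r) / C * C = A - W * r"
proof -
  have u: "fps_nth (A + W * r) 0 \<noteq> 0" using assms by simp
  have "(A - W * r) * (A + W * r) = C * C"
    using assms(1) by (simp add: algebra_simps power2_eq_square)
  hence "(A - W * r) * (A + W * r) * inverse (A + W * r) = C * C * inverse (A + W * r)"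
    by simp
  hence eq: "A - W * r = C * inverse (A + W * r) * C"
    by (simp add: mult.assoc inverse_mult_eq_1'[OF u])
  thus "(A - W * r) / C = C * inverse (A + W * r)" using \<open>C \<noteq> 0\<close> by simp
  thus "(A - W * r) / C * C = A - W * r" using eq by simp
qed

lemma uS_exact:
  "uS = 2 * (1 - yS) * tS * inverse (1 + tS ^ 2 - 2 * yS * tS + (1 - tS) * sqrtS)"
  "uS * (2 * (1 - yS) * tS) = 1 + tS ^ 2 - 2 * yS * tS - (1 - tS) * sqrtS"
proof -
  have "(1 - yS) \<noteq> 0" "(2 :: Qqy fps) \<noteq> 0" "tS \<noteq> 0"
    using indet_y_neq by (simp_all add: yS_def tS_def flip: fps_const_1_eq_1)
  hence C: "2 * (1 - yS) * tS \<noteq> 0" by simp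
  have "(1 + tS ^ 2 - 2 * yS * tS) ^ 2 - (1 - tS) ^ 2 * sqrtS ^ 2 = (2 * (1 - yS) * tS) ^ 2"
    unfolding sqrtS(2) by algebra
  note * = exact_quotient[OF this _ _ sqrtS(1) C]
  show "uS = 2 * (1 - yS) * tS * inverse (1 + tS ^ 2 - 2 * yS * tS + (1 - tS) * sqrtS)"
    "uS * (2 * (1 - yS) * tS) = 1 + tS ^ 2 - 2 * yS * tS - (1 - tS) * sqrtS"
    unfolding uS_def by (rule *; simp add: tS_def power2_eq_square)+
qed

lemma vS_exact:
  "vS = 2 * yS * tS * inverse ((1 + tS) ^ 2 - 2 * yS * tS + (1 + tS) * sqrtS)"
  "vS * (2 * yS * tS) = (1 + tS) ^ 2 - 2 * yS * tS - (1 + tS) * sqrtS"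
proof -
  have "yS \<noteq> 0" "(2 :: Qqy fps) \<noteq> 0" "tS \<noteq> 0"
    using indet_y_neq by (simp_all add: yS_def tS_def)
  hence C: "2 * yS * tS \<noteq> 0" by simp
  have "((1 + tS) ^ 2 - 2 * yS * tS) ^ 2 - (1 + tS) ^ 2 * sqrtS ^ 2 = (2 * yS * tS) ^ 2"
    unfolding sqrtS(2) by algebra
  note * = exact_quotient[OF this _ _ sqrtS(1) C]
  show "vS = 2 * yS * tS * inverse ((1 + tS) ^ 2 - 2 * yS * tS + (1 + tS) * sqrtS)"
    "vS * (2 * yS * tS) = (1 + tS) ^ 2 - 2 * yS * tS - (1 + tS) * sqrtS"
    unfolding vS_def by (rule *; simp add: tS_def power2_eq_square)+
qed

text \<open>The subring $\mathbb{Q}[y]$ of $\mathbb{Q}(q)(y)$.\<close>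

definition Qy :: "Qqy set" where
  "Qy = range (\<lambda>p :: rat poly. to_fract (map_poly of_rat p))"

lemma Qy_add: "a \<in> Qy \<Longrightarrow> b \<in> Qy \<Longrightarrow> a + b \<in> Qy"
proof -
  have "map_poly of_rat (p + q) = (map_poly of_rat p + map_poly of_rat q :: Qq poly)" for p q
    by (rule poly_eqI) (simp add: coeff_map_poly of_rat_add)
  thus "a \<in> Qy \<Longrightarrow> b \<in> Qy \<Longrightarrow> a + b \<in> Qy"
    unfolding Qy_def by (metis (no_types, lifting) imageE rangeI to_fract_add)
qed

lemma Qy_mult: "a \<in> Qy \<Longrightarrow> b \<in> Qy \<Longrightarrow> a * b \<in> Qy"
proof -
  have "map_poly of_rat (p * q) = (map_poly of_rat p * map_poly of_rat q :: Qq poly)" for p q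
    by (rule poly_eqI) (simp add: coeff_map_poly coeff_mult of_rat_sum of_rat_mult)
  thus "a \<in> Qy \<Longrightarrow> b \<in> Qy \<Longrightarrow> a * b \<in> Qy"
    unfolding Qy_def by (metis (no_types, lifting) imageE rangeI to_fract_mult)
qed

lemma Qy_of_rat: "to_fract [: of_rat c :] \<in> Qy"
  unfolding Qy_def by (rule range_eqI[of _ _ "[:c:]"]) (simp add: map_poly_pCons)

lemma Qy_0: "0 \<in> Qy" and Qy_1: "1 \<in> Qy" and Qy_m1: "-1 \<in> Qy" and Qy_half: "1 / 2 \<in> Qy"
proof -
  show "0 \<in> Qy" using Qy_of_rat[of 0] by simp
  show "1 \<in> Qy" using Qy_of_rat[of 1] by (simp add: one_pCons[symmetric])
  have "to_fract [: of_rat (-1) :] = - to_fract [: 1 :: Qq :]"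
    by (simp flip: to_fract_uminus)
  thus "-1 \<in> Qy" using Qy_of_rat[of "-1"] by (simp add: one_pCons[symmetric])
  have "to_fract [: of_rat (1/2) :] * 2 = (1 :: Qqy)"
  proof -
    have "to_fract [: of_rat (1/2) :] * 2
        = to_fract [: of_rat (1/2) :] + to_fract [: of_rat (1/2) :: Qq :]"
      by simp
    also have "\<dots> = to_fract ([: of_rat (1/2) :] + [: of_rat (1/2) :])"
      by (rule to_fract_add[symmetric])
    also have "\<dots> = 1" by (simp add: one_pCons[symmetric] flip: of_rat_add)
    finally show ?thesis .
  qed
  hence "1 / 2 = (to_fract [: of_rat (1/2) :] :: Qqy)" by (simp add: field_simps)
  thus "1 / 2 \<in> Qy" by (simp only: Qy_of_rat)
qed

lemma Qy_diff: "a \<in> Qy \<Longrightarrow> b \<in> Qy \<Longrightarrow> a - b \<in> Qy"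
  using Qy_add[of a "-1 * b"] Qy_mult[OF Qy_m1, of b] by simp

lemma Qy_sum: "(\<And>i. i \<in> I \<Longrightarrow> f i \<in> Qy) \<Longrightarrow> sum f I \<in> Qy"
  by (induction I rule: infinite_finite_induct) (auto intro: Qy_0 Qy_add)

lemma Qy_y: "indet_y \<in> Qy"
  unfolding Qy_def indet_y_def
  by (rule range_eqI[of _ _ "[:0, 1:]"]) (simp add: map_poly_pCons)

definition Qy_fps :: "Qqy fps set" where
  "Qy_fps = {f. \<forall>n. fps_nth f n \<in> Qy}"

lemma Qy_fps_add: "f \<in> Qy_fps \<Longrightarrow> g \<in> Qy_fps \<Longrightarrow> f + g \<in> Qy_fps"
  and Qy_fps_diff: "f \<in> Qy_fps \<Longrightarrow> g \<in> Qy_fps \<Longrightarrow> f - g \<in> Qy_fps"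
  and Qy_fps_mult: "f \<in> Qy_fps \<Longrightarrow> g \<in> Qy_fps \<Longrightarrow> f * g \<in> Qy_fps"
  by (auto simp: Qy_fps_def fps_mult_nth intro!: Qy_add Qy_diff Qy_sum Qy_mult)

lemma Qy_fps_1: "1 \<in> Qy_fps" and Qy_fps_t: "tS \<in> Qy_fps" and Qy_fps_y: "yS \<in> Qy_fps"
  by (auto simp: Qy_fps_def tS_def yS_def fps_X_def Qy_0 Qy_1 Qy_y)

lemma Qy_fps_2: "2 \<in> Qy_fps"
  using Qy_fps_add[OF Qy_fps_1 Qy_fps_1] by simp

lemma Qy_fps_4: "4 \<in> Qy_fps"
  using Qy_fps_add[OF Qy_fps_2 Qy_fps_2] by simp

lemmas Qy_fps_intros =
  Qy_fps_add Qy_fps_diff Qy_fps_mult Qy_fps_1 Qy_fps_2 Qy_fps_4 Qy_fps_t Qy_fps_y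

lemma Qy_fps_inverse:
  assumes "f \<in> Qy_fps" "fps_nth f 0 = 2"
  shows "inverse f \<in> Qy_fps"
proof -
  have "fps_nth (inverse f) n \<in> Qy" for n
  proof (induction n rule: less_induct)
    case (less n)
    show ?case
    proof (cases n)
      case 0
      thus ?thesis using assms Qy_half by (simp add: inverse_eq_divide)
    next
      case (Suc m)
      have "(-1) * (1 / 2) * (\<Sum>i=1..n. fps_nth f i * fps_nth (inverse f) (n - i)) \<in> Qy"
        using assms(1) less Suc
        by (intro Qy_mult Qy_m1 Qy_half Qy_sum) (auto simp: Qy_fps_def)
      thus ?thesis using assms(2) Suc by (simp add: fps_inverse_def)
    qed
  qed
  thus ?thesis by (simp add: Qy_fps_def)
qed

lemma sqrtS_Qy: "sqrtS \<in> Qy_fps"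
proof -
  have D: "(1 + tS) ^ 2 - 4 * yS * tS \<in> Qy_fps"
    unfolding power2_eq_square by (intro Qy_fps_intros)
  have "fps_nth sqrtS n \<in> Qy" for n
  proof (induction n rule: less_induct)
    case (less n)
    show ?case
    proof (cases n)
      case 0
      thus ?thesis using sqrtS(1) Qy_1 by simp
    next
      case (Suc m)
      let ?S = "\<Sum>i\<in>{1..m}. fps_nth sqrtS i * fps_nth sqrtS (n - i)"
      have "fps_nth ((1 + tS) ^ 2 - 4 * yS * tS) n
          = (\<Sum>i=0..n. fps_nth sqrtS i * fps_nth sqrtS (n - i))"
        by (simp only: sqrtS(2)[symmetric] power2_eq_square[of sqrtS] fps_mult_nth)
      also have "\<dots> = 2 * fps_nth sqrtS n + ?S"
        using sqrtS(1) Suc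
        by (simp add: sum.atLeast_Suc_atMost[of 0 m] atLeastAtMostSuc_conv)
      finally have "fps_nth sqrtS n = 1 / 2 * (fps_nth ((1 + tS) ^ 2 - 4 * yS * tS) n - ?S)"
        by simp
      also have "\<dots> \<in> Qy"
        using D less Suc by (intro Qy_mult Qy_half Qy_diff Qy_sum) (auto simp: Qy_fps_def)
      finally show ?thesis .
    qed
  qed
  thus ?thesis by (simp add: Qy_fps_def)
qed

lemma uS_Qy: "uS \<in> Qy_fps"
  unfolding uS_exact(1) power2_eq_square
  by (intro Qy_fps_intros Qy_fps_inverse sqrtS_Qy) (simp add: tS_def sqrtS(1))

lemma vS_Qy: "vS \<in> Qy_fps"
  unfolding vS_exact(1) power2_eq_square
  by (intro Qy_fps_intros Qy_fps_inverse sqrtS_Qy) (simp add: tS_def sqrtS(1))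

end

theory Submission
  imports Defs
begin

text \<open>
  Expand the left-hand side as \<open>(1 - t) \<Sum>\<^sub>k t\<^sup>k exp\<^sub>q (Exp\<^sub>q exp\<^sub>q)\<^sup>k\<close>: its coefficients count
  permutations cut into alternately increasing and decreasing blocks, where an entry of a
  decreasing block carries a factor \<open>y\<close>.  For a fixed permutation the cuts are generated by a
  two-state automaton (is the current entry in an increasing or a decreasing block?).  After an
  ascent its state vector is proportional to \<open>(1, y t)\<close>, after a descent to \<open>(1, y)\<close>, and the
  factors picked up are \<open>(1 + y t) / (1 - t)\<close> for an ascent, \<open>(1 + y)\<^sup>2 t / ((1 - t) (1 + y t))\<close> for
  the first descent of a run, \<open>(y + t) / (1 - t)\<close> for the others; this is the weight by \<open>lpk\<close> and
  \<open>des\<close>.  To avoid standardizing the blocks, permutations are built by prescribing their last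
  value, which turns the two components of the state vector into sequences satisfying linear
  recurrences that Gaussian binomial coefficients solve.  The second identity is the first one at
  \<open>y = u\<close>, \<open>t = v\<close> with \<open>x\<close> rescaled.
\<close>

section \<open>Gaussian binomial coefficients\<close>

text \<open>Based on a q-Pascal rule instead of a quotient of q-factorials, so that it makes sense
  in every commutative ring.\<close>

fun qbinom :: "'a \<Rightarrow> nat \<Rightarrow> nat \<Rightarrow> 'a::comm_ring_1" where
  "qbinom q n 0 = 1"
| "qbinom q 0 (Suc m) = 0"
| "qbinom q (Suc n) (Suc m) = q ^ Suc m * qbinom q n (Suc m) + qbinom q n m"

lemma qbinom_eq_0: "n < m \<Longrightarrow> qbinom q n m = 0"
proof (induction n arbitrary: m)
  case 0
  thus ?case by (cases m) auto
next
  case (Suc n)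
  thus ?case by (cases m) auto
qed

text \<open>The ratio of neighbouring Gaussian binomials with denominators cleared; the factor
  \<open>q ^ m\<close> avoids the exponent \<open>n - m\<close>. It measures the difference between
  the two q-Pascal rules.\<close>

lemma qbinom_absorb:
  "q ^ m * (q ^ Suc m - 1) * qbinom q n (Suc m) = (q ^ n - q ^ m) * qbinom q n m"
proof (induction n arbitrary: m)
  case 0
  show ?case by (cases m) auto
next
  case (Suc n)
  have "q ^ m * (q ^ Suc m - 1) * qbinom q (Suc n) (Suc m)
      = q ^ Suc m * (q ^ m * (q ^ Suc m - 1) * qbinom q n (Suc m))
        + q ^ m * (q ^ Suc m - 1) * qbinom q n m"
    by (simp add: algebra_simps)
  also have "\<dots> = (q ^ Suc m * (q ^ n - q ^ m) + q ^ m * (q ^ Suc m - 1)) * qbinom q n m"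
    unfolding Suc.IH by (simp add: algebra_simps)
  also have "\<dots> = (q ^ (Suc m + n) - q ^ m) * qbinom q n m"
    by (simp add: algebra_simps power_add)
  also have "\<dots> = (q ^ Suc n - q ^ m) * qbinom q (Suc n) m"
  proof (cases m)
    case (Suc k)
    have "(q ^ Suc n - q ^ m) * qbinom q (Suc n) m
        = q ^ m * (q ^ Suc n - q ^ m) * qbinom q n m + q * ((q ^ n - q ^ k) * qbinom q n k)"
      by (simp add: Suc algebra_simps)
    also have "\<dots> = (q ^ m * (q ^ Suc n - q ^ m) + q ^ m * (q ^ m - 1)) * qbinom q n m"
      unfolding Suc.IH[symmetric] by (simp add: Suc algebra_simps)
    also have "\<dots> = (q ^ (Suc m + n) - q ^ m) * qbinom q n m"
      by (simp add: algebra_simps power_add)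
    finally show ?thesis by simp
  qed simp
  finally show ?case .
qed

text \<open>The second q-Pascal rule, multiplied by \<open>q ^ m\<close>: the first rule corrected
  by \<open>qbinom_absorb\<close>.\<close>

lemma qbinom_Suc_Suc':
  "q ^ m * qbinom q (Suc n) (Suc m) = q ^ m * qbinom q n (Suc m) + q ^ n * qbinom q n m"
  using qbinom_absorb[of q m n] by (simp add: algebra_simps)

text \<open>The second q-Pascal rule telescopes; this sums over decreasing blocks.\<close>

lemma sum_power_mult_qbinom:
  "(\<Sum>i<n. q ^ i * qbinom q i m) = q ^ m * qbinom q n (Suc m)"
  by (induction n) (simp_all add: qbinom_Suc_Suc' del: qbinom.simps(3))

text \<open>The first q-Pascal rule unrolled in \<open>n\<close>; this sums over increasing
  blocks.\<close>

lemma sum_rev_power_mult_qbinom: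
  "(\<Sum>i<n. q ^ (Suc m * (n - Suc i)) * qbinom q i m) = qbinom q n (Suc m)"
proof (induction n)
  case (Suc n)
  have "(\<Sum>i<n. q ^ (Suc m * (n - i)) * qbinom q i m)
      = q ^ Suc m * (\<Sum>i<n. q ^ (Suc m * (n - Suc i)) * qbinom q i m)"
    unfolding sum_distrib_left
  proof (rule sum.cong)
    fix i assume "i \<in> {..<n}"
    hence "n - i = Suc (n - Suc i)" by simp
    thus "q ^ (Suc m * (n - i)) * qbinom q i m
        = q ^ Suc m * (q ^ (Suc m * (n - Suc i)) * qbinom q i m)"
      by (simp add: power_add algebra_simps)
  qed simp
  thus ?case using Suc by simp
qed simp

section \<open>Gaussian binomials and q-factorials\<close>

lemma qfact_0 [simp]: "qfact q 0 = 1"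
  by (simp add: qfact_def)

lemma qfact_Suc: "qfact q (Suc n) = qfact q n * (\<Sum>i<Suc n. q ^ i)"
  by (simp add: qfact_def)

lemma sum_power_add:
  fixes q :: "'a::comm_ring_1"
  shows "(\<Sum>i<m + n. q ^ i) = (\<Sum>i<m. q ^ i) + q ^ m * (\<Sum>i<n. q ^ i)"
  by (induction n) (simp_all add: algebra_simps power_add)

text \<open>By the q-Pascal rule both terms are multiples of the q-factorial of
  \<open>m + n - 1\<close>, and their cofactors add up to the q-integer of \<open>m + n\<close> by
  \<open>sum_power_add\<close>.\<close>

lemma qbinom_mult_qfact: "qbinom q (m + n) m * qfact q m * qfact q n = qfact q (m + n)"
proof (induction "m + n" arbitrary: m n)
  case (Suc N)
  show ?case
  proof (cases m)
    case (Suc k)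
    note m = this
    show ?thesis
    proof (cases n)
      case 0
      have "qbinom q m m = 1" for m by (induction m) (auto simp: qbinom_eq_0)
      thus ?thesis by (simp add: 0)
    next
      case (Suc l)
      have IH1: "qbinom q (m + l) m * qfact q m * qfact q l = qfact q (m + l)"
        and IH2: "qbinom q (k + n) k * qfact q k * qfact q n = qfact q (m + l)"
        using Suc.hyps(1)[of m l] Suc.hyps(1)[of k n] Suc.hyps(2) m Suc by simp_all
      have "qbinom q (m + n) m = q ^ m * qbinom q (m + l) m + qbinom q (k + n) k"
        using m Suc by simp
      hence "qbinom q (m + n) m * qfact q m * qfact q n
          = q ^ m * (\<Sum>i<n. q ^ i) * (qbinom q (m + l) m * qfact q m * qfact q l)
            + (\<Sum>i<m. q ^ i) * (qbinom q (k + n) k * qfact q k * qfact q n)"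
        unfolding Suc m qfact_Suc by (simp add: algebra_simps del: qbinom.simps sum.lessThan_Suc)
      also have "\<dots> = qfact q (m + l) * (\<Sum>i<m + n. q ^ i)"
        unfolding IH1 IH2 sum_power_add by (simp add: algebra_simps)
      also have "\<dots> = qfact q (m + n)"
        using qfact_Suc[of q "m + l"] by (simp add: Suc)
      finally show ?thesis .
    qed
  qed simp
qed simp

text \<open>\<open>\<phi> n\<close> stands for the reciprocal q-factorial, kept abstract to cover
  both coefficient rings. The identity turns convolutions with Gaussian binomials into products of
  series.\<close>

lemma qbinom_Suc_Suc_inverse_qfact:
  assumes \<phi>: "\<And>n. \<phi> n * qfact q n = 1" and "m \<le> n"
  shows "\<phi> (Suc n) * qbinom q (Suc n) (Suc m) = \<phi> (Suc m) * \<phi> (n - m)"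
proof -
  have *: "qbinom q (Suc n) (Suc m) * qfact q (Suc m) * qfact q (n - m) = qfact q (Suc n)"
    using qbinom_mult_qfact[of q "Suc m" "n - m"] \<open>m \<le> n\<close> by simp
  have "\<phi> (Suc n) * qbinom q (Suc n) (Suc m)
      = \<phi> (Suc n) * qbinom q (Suc n) (Suc m)
        * (\<phi> (Suc m) * qfact q (Suc m)) * (\<phi> (n - m) * qfact q (n - m))"
    by (simp add: \<phi> del: qbinom.simps)
  also have "\<dots> = \<phi> (Suc m) * \<phi> (n - m) * (\<phi> (Suc n) *
      (qbinom q (Suc n) (Suc m) * qfact q (Suc m) * qfact q (n - m)))"
    by (simp only: ac_simps)
  finally show ?thesis by (simp add: * \<phi> del: qbinom.simps)
qed


section \<open>Two linear recurrences\<close>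

text \<open>Here \<open>j\<close> is a last value counted from 0, with \<open>n - j\<close> larger
  values before it. Unrolling chooses the length \<open>Suc m\<close> of the last increasing block,
  \<open>c (n - m)\<close> being the weight of opening it; the Gaussian binomial counts the choices
  of its values.\<close>

lemma sum_increasing_recurrence:
  fixes q :: "'a::comm_ring_1"
  assumes rec: "\<And>n j. j \<le> n \<Longrightarrow> u (Suc n) j = q ^ (n - j) * (c n + (\<Sum>i<j. u n i))"
  shows "(\<Sum>j<Suc n. u (Suc n) j) = (\<Sum>m\<le>n. c (n - m) * qbinom q (Suc n) (Suc m))"
proof -
  \<comment> \<open>Each of the \<open>Suc m\<close> letters of a block with maximum
    \<open>j\<close> has \<open>n - j\<close> larger values before it; \<open>qbinom q j m\<close>
    accounts for the \<open>m\<close> letters below \<open>j\<close>.\<close>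
  have *: "u (Suc n) j = (\<Sum>m\<le>n. c (n - m) * (q ^ (Suc m * (n - j)) * qbinom q j m))"
    if "j \<le> n" for j n
    using that
  proof (induction n arbitrary: j)
    case 0
    thus ?case by (simp add: rec)
  next
    case (Suc n)
    have hs: "(\<Sum>i<j. q ^ (Suc m * (n - i)) * qbinom q i m)
        = q ^ (Suc m * (Suc n - j)) * qbinom q j (Suc m)" for m
    proof -
      have "(\<Sum>i<j. q ^ (Suc m * (n - i)) * qbinom q i m)
          = (\<Sum>i<j. q ^ (Suc m * (Suc n - j)) * (q ^ (Suc m * (j - Suc i)) * qbinom q i m))"
      proof (rule sum.cong)
        fix i assume "i \<in> {..<j}"
        hence "n - i = (Suc n - j) + (j - Suc i)" using Suc.prems by simp
        thus "q ^ (Suc m * (n - i)) * qbinom q i m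
            = q ^ (Suc m * (Suc n - j)) * (q ^ (Suc m * (j - Suc i)) * qbinom q i m)"
          by (metis (no_types, lifting) add_mult_distrib2 mult.assoc power_add)
      qed simp
      thus ?thesis by (simp only: sum_distrib_left[symmetric] sum_rev_power_mult_qbinom)
    qed
    have "(\<Sum>i<j. u (Suc n) i)
        = (\<Sum>i<j. \<Sum>m\<le>n. c (n - m) * (q ^ (Suc m * (n - i)) * qbinom q i m))"
      using Suc by (intro sum.cong) auto
    also have "\<dots> = (\<Sum>m\<le>n. c (n - m) * (q ^ (Suc m * (Suc n - j)) * qbinom q j (Suc m)))"
      by (subst sum.swap) (simp only: sum_distrib_left[symmetric] hs)
    finally have "u (Suc (Suc n)) j = q ^ (Suc n - j) * (c (Suc n) +
        (\<Sum>m\<le>n. c (n - m) * (q ^ (Suc m * (Suc n - j)) * qbinom q j (Suc m))))"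
      using Suc.prems by (simp add: rec)
    \<comment> \<open>Opening a new block, \<open>c (Suc n)\<close>, is the term
      \<open>m = 0\<close>; extending a block shifts \<open>m\<close> to
      \<open>Suc m\<close>.\<close>
    also have "\<dots> = (\<Sum>m\<le>Suc n. c (Suc n - m) * (q ^ (Suc m * (Suc n - j)) * qbinom q j m))"
      by (simp add: sum.atMost_Suc_shift sum_distrib_left distrib_left power_add mult_ac
            del: sum.atMost_Suc)
    finally show ?case .
  qed
  have "(\<Sum>j<Suc n. u (Suc n) j)
      = (\<Sum>j<Suc n. \<Sum>m\<le>n. c (n - m) * (q ^ (Suc m * (n - j)) * qbinom q j m))"
    by (intro sum.cong) (auto simp: *)
  also have "\<dots> = (\<Sum>m\<le>n. c (n - m) * (\<Sum>j<Suc n. q ^ (Suc m * (Suc n - Suc j)) * qbinom q j m))"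
    by (subst sum.swap) (simp only: sum_distrib_left diff_Suc_Suc)
  finally show ?thesis by (simp only: sum_rev_power_mult_qbinom)
qed

text \<open>For a decreasing block the inversions inside it add the exponent
  \<open>Suc m choose 2\<close>. Each letter after the first brings a factor \<open>y\<close>; the
  factor of the first belongs to \<open>d\<close>.\<close>

lemma sum_decreasing_recurrence:
  fixes q y :: "'a::comm_ring_1"
  assumes rec: "\<And>n j. j \<le> n \<Longrightarrow> p (Suc n) j = q ^ (n - j) * (d n + y * (\<Sum>i=j..<n. p n i))"
  shows "(\<Sum>j<Suc n. p (Suc n) j)
    = (\<Sum>m\<le>n. d (n - m) * (y ^ m * q ^ (Suc m choose 2) * qbinom q (Suc n) (Suc m)))"
proof -
  have choose: "Suc m choose 2 = (m choose 2) + m" for m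
    by (simp add: numeral_2_eq_2)
  have hs: "(\<Sum>i<k. q ^ i * (y ^ m * q ^ (m choose 2) * qbinom q i m))
      = y ^ m * q ^ (Suc m choose 2) * qbinom q k (Suc m)" for k m
  proof -
    have "(\<Sum>i<k. q ^ i * (y ^ m * q ^ (m choose 2) * qbinom q i m))
        = y ^ m * q ^ (m choose 2) * (\<Sum>i<k. q ^ i * qbinom q i m)"
      by (simp add: sum_distrib_left mult_ac)
    thus ?thesis unfolding sum_power_mult_qbinom choose by (simp add: power_add mult_ac)
  qed
  \<comment> \<open>Counting values from the top turns the range \<open>i \<ge> j\<close> into an
    initial segment, to which \<open>hs\<close> applies.\<close>
  have rev: "(\<Sum>i=j..<Suc n. f (n - i)) = (\<Sum>i<Suc n - j. f i)" for f :: "nat \<Rightarrow> 'a" and n j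
    by (rule sum.reindex_bij_witness[of _ "\<lambda>i. n - i" "\<lambda>i. n - i"]) auto
  have *: "p (Suc n) j
      = (\<Sum>m\<le>n. d (n - m) * (q ^ (n - j) * (y ^ m * q ^ (m choose 2) * qbinom q (n - j) m)))"
    if "j \<le> n" for j n
    using that
  proof (induction n arbitrary: j)
    case 0
    thus ?case by (simp add: rec numeral_2_eq_2)
  next
    case (Suc n)
    have "(\<Sum>i=j..<Suc n. p (Suc n) i) = (\<Sum>i=j..<Suc n. \<Sum>m\<le>n.
        d (n - m) * (q ^ (n - i) * (y ^ m * q ^ (m choose 2) * qbinom q (n - i) m)))"
      using Suc by (intro sum.cong) auto
    also have "\<dots> = (\<Sum>m\<le>n. d (n - m) *
        (y ^ m * q ^ (Suc m choose 2) * qbinom q (Suc n - j) (Suc m)))"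
      by (subst sum.swap, simp only: sum_distrib_left[symmetric])
        (simp only: rev[where f = "\<lambda>k. q ^ k * (y ^ _ * q ^ _ * qbinom q k _)"] hs)
    finally have "p (Suc (Suc n)) j = q ^ (Suc n - j) * (d (Suc n) + y * (\<Sum>m\<le>n.
        d (n - m) * (y ^ m * q ^ (Suc m choose 2) * qbinom q (Suc n - j) (Suc m))))"
      using Suc.prems rec[of j "Suc n"] by simp
    also have "\<dots> = (\<Sum>m\<le>Suc n. d (Suc n - m) *
        (q ^ (Suc n - j) * (y ^ m * q ^ (m choose 2) * qbinom q (Suc n - j) m)))"
      unfolding sum.atMost_Suc_shift
      by (simp add: sum_distrib_left distrib_left mult_ac numeral_2_eq_2)
    finally show ?case .
  qed
  have "(\<Sum>j<Suc n. p (Suc n) j) = (\<Sum>j=0..<Suc n. \<Sum>m\<le>n.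
      d (n - m) * (q ^ (n - j) * (y ^ m * q ^ (m choose 2) * qbinom q (n - j) m)))"
    by (intro sum.cong) (auto simp: *)
  also have "\<dots> = (\<Sum>m\<le>n. d (n - m) *
      (y ^ m * q ^ (Suc m choose 2) * qbinom q (Suc n) (Suc m)))"
    by (subst sum.swap, simp only: sum_distrib_left[symmetric])
      (simp only: rev[where f = "\<lambda>k. q ^ k * (y ^ _ * q ^ _ * qbinom q k _)"] hs diff_zero)
  finally show ?thesis .
qed


section \<open>Permutations with a prescribed last value\<close>

text \<open>The cycle on \<open>{v..Suc n}\<close> sending \<open>Suc n\<close> to \<open>v\<close>.
  Applied after a permutation of \<open>{1..n}\<close>, it appends the letter \<open>v\<close> and
  raises the old values from \<open>v\<close> on.\<close>

definition bump :: "nat \<Rightarrow> nat \<Rightarrow> nat \<Rightarrow> nat" where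
  "bump n v i = (if i = Suc n then v else if v \<le> i \<and> i \<le> n then Suc i else i)"

lemma bump_permutes: "v \<in> {1..Suc n} \<Longrightarrow> bump n v permutes {1..Suc n}"
  by (rule inj_imp_permutes) (auto simp: bump_def inj_on_def split: if_splits)

text \<open>A single letter counts as reached by an ascent, so that an initial descent makes a left
  peak, as in \<open>lpk\<close>.\<close>

definition last_up :: "nat \<Rightarrow> (nat \<Rightarrow> nat) \<Rightarrow> bool" where
  "last_up n \<pi> \<longleftrightarrow> n = 1 \<or> \<pi> (n - 1) < \<pi> n"

section \<open>Effect of appending a last letter on the statistics\<close>

context
  fixes n v :: nat and \<sigma> \<pi> :: "nat \<Rightarrow> nat"
  assumes n: "1 \<le> n" and v: "v \<in> {1..Suc n}" and \<sigma>: "\<sigma> permutes {1..n}"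
    and \<pi>: "\<pi> = bump n v \<circ> \<sigma>"
begin

lemma bump_comp_last: "\<pi> (Suc n) = v"
  using \<sigma> by (auto simp: \<pi> bump_def permutes_def)

text \<open>An old value equal to \<open>v\<close> is raised to \<open>Suc v\<close>; hence one
  strict and one weak comparison with \<open>v\<close>.\<close>

lemma bump_comp_less_iff:
  assumes "i \<in> {1..n}"
  shows "j \<in> {1..n} \<Longrightarrow> \<pi> i < \<pi> j \<longleftrightarrow> \<sigma> i < \<sigma> j"
    and "\<pi> i < \<pi> (Suc n) \<longleftrightarrow> \<sigma> i < v" and "\<pi> (Suc n) < \<pi> i \<longleftrightarrow> v \<le> \<sigma> i"
proof -
  have "\<sigma> i \<in> {1..n}" using assms \<sigma> by (simp only: permutes_in_image)
  thus "\<pi> i < \<pi> (Suc n) \<longleftrightarrow> \<sigma> i < v" "\<pi> (Suc n) < \<pi> i \<longleftrightarrow> v \<le> \<sigma> i"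
    unfolding bump_comp_last by (auto simp: \<pi> bump_def)
  assume "j \<in> {1..n}"
  hence "\<sigma> j \<in> {1..n}" using \<sigma> by (simp only: permutes_in_image)
  thus "\<pi> i < \<pi> j \<longleftrightarrow> \<sigma> i < \<sigma> j" using \<open>\<sigma> i \<in> {1..n}\<close> by (auto simp: \<pi> bump_def)
qed

lemma last_up_bump_comp: "last_up (Suc n) \<pi> \<longleftrightarrow> \<sigma> n < v"
  using n bump_comp_less_iff(2)[of n] by (simp add: last_up_def)

lemma des_bump_comp: "des (Suc n) \<pi> = des n \<sigma> + (if \<sigma> n < v then 0 else 1)"
proof -
  have "{i \<in> {1..Suc n - 1}. \<pi> i > \<pi> (i + 1)}
      = {i \<in> {1..n - 1}. \<sigma> i > \<sigma> (i + 1)} \<union> (if \<sigma> n < v then {} else {n})" (is "?L = ?R")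
  proof (rule set_eqI)
    fix i show "i \<in> ?L \<longleftrightarrow> i \<in> ?R"
      using n bump_comp_less_iff(1)[of "i + 1" i] bump_comp_less_iff(3)[of n]
      by (cases "i = n") auto
  qed
  moreover have "n \<notin> {i \<in> {1..n - 1}. \<sigma> i > \<sigma> (i + 1)}" using n by auto
  ultimately show ?thesis unfolding des_def by (simp del: atLeastAtMost_iff)
qed

text \<open>An appended descent makes position \<open>n\<close> a left peak exactly if the old word
  ended upwards; earlier positions keep their status.\<close>

lemma lpk_bump_comp:
  "lpk (Suc n) \<pi> = lpk n \<sigma> + (if \<sigma> n < v then 0 else if last_up n \<sigma> then 1 else 0)"
proof -
  have "{i \<in> {1..Suc n - 1}. (2 \<le> i \<and> \<pi> (i-1) < \<pi> i \<and> \<pi> i > \<pi> (i+1)) \<or> (i = 1 \<and> \<pi> 1 > \<pi> 2)}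
      = {i \<in> {1..n - 1}. (2 \<le> i \<and> \<sigma> (i-1) < \<sigma> i \<and> \<sigma> i > \<sigma> (i+1)) \<or> (i = 1 \<and> \<sigma> 1 > \<sigma> 2)}
        \<union> (if \<not> \<sigma> n < v \<and> last_up n \<sigma> then {n} else {})" (is "?L = ?R")
  proof (rule set_eqI)
    fix i
    consider "i = n" | "1 \<le> i" "i < n" | "i = 0 \<or> n < i" by linarith
    thus "i \<in> ?L \<longleftrightarrow> i \<in> ?R"
    proof cases
      case 1
      thus ?thesis
        using n bump_comp_less_iff(1)[of "n - 1" n] bump_comp_less_iff(3)[of n]
        by (cases "n = 1") (auto simp: last_up_def numeral_2_eq_2)
    next
      case 2
      hence "\<pi> (i + 1) < \<pi> i \<longleftrightarrow> \<sigma> (i + 1) < \<sigma> i"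
        and "i \<noteq> 1 \<Longrightarrow> \<pi> (i - 1) < \<pi> i \<longleftrightarrow> \<sigma> (i - 1) < \<sigma> i"
        using 2 bump_comp_less_iff(1)[of "i + 1" i] bump_comp_less_iff(1)[of "i - 1" i]
        by (simp_all add: Suc_le_eq)
      thus ?thesis
        using 2 by (cases "i = 1") (auto simp: numeral_2_eq_2)
    qed (use n in auto)
  qed
  moreover have "n \<notin> {1..n - 1}" using n by auto
  ultimately show ?thesis unfolding lpk_def by (simp del: atLeastAtMost_iff)
qed

lemma inv_num_bump_comp: "inv_num (Suc n) \<pi> = inv_num n \<sigma> + (Suc n - v)"
proof -
  define I where "I = {i \<in> {1..n}. v \<le> \<sigma> i}"
  let ?A = "{(i, j). 1 \<le> i \<and> i < j \<and> j \<le> n \<and> \<sigma> i > \<sigma> j}"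
  have "{(i, j). 1 \<le> i \<and> i < j \<and> j \<le> Suc n \<and> \<pi> i > \<pi> j} = ?A \<union> (\<lambda>i. (i, Suc n)) ` I"
    (is "?L = ?R")
  proof (rule set_eqI, clarify)
    fix i j
    show "(i, j) \<in> ?L \<longleftrightarrow> (i, j) \<in> ?R"
      using bump_comp_less_iff(1)[of j i] bump_comp_less_iff(3)[of i]
      by (cases "j = Suc n") (auto simp: I_def)
  qed
  moreover have "finite ?A"
    by (rule finite_subset[of _ "{1..n} \<times> {1..n}"]) auto
  moreover have "?A \<inter> (\<lambda>i. (i, Suc n)) ` I = {}" by auto
  moreover have "card ((\<lambda>i. (i, Suc n)) ` I) = Suc n - v"
  proof -
    \<comment> \<open>The new inversions pair the last position with those of the values from
      \<open>v\<close> to \<open>n\<close>, each of which occurs exactly once.\<close>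
    have "\<sigma> ` I = {v..n}"
    proof (intro equalityI subsetI)
      fix k assume "k \<in> {v..n}"
      hence "k \<in> {1..n}" using v by auto
      hence "k \<in> \<sigma> ` {1..n}" using permutes_image[OF \<sigma>] by simp
      thus "k \<in> \<sigma> ` I" using \<open>k \<in> {v..n}\<close> by (auto simp: I_def)
    qed (use permutes_in_image[OF \<sigma>] in \<open>auto simp: I_def\<close>)
    hence "card I = card {v..n}"
      using card_image[of \<sigma> I] permutes_inj[OF \<sigma>] by (metis inj_on_subset subset_UNIV)
    thus ?thesis by (simp add: card_image inj_on_def)
  qed
  moreover have "finite I" by (simp add: I_def)
  ultimately show ?thesis
    by (simp add: inv_num_def card_Un_disjoint)
qed

end

lemma bij_betw_bump_comp:
  assumes v: "v \<in> {1..Suc n}"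
  shows "bij_betw (\<lambda>\<sigma>. bump n v \<circ> \<sigma>) {\<sigma>. \<sigma> permutes {1..n}}
    {\<pi>. \<pi> permutes {1..Suc n} \<and> \<pi> (Suc n) = v}"
proof (rule bij_betwI[where g = "\<lambda>\<pi>. inv (bump n v) \<circ> \<pi>"])
  note b = bump_permutes[OF v]
  show "(\<lambda>\<sigma>. bump n v \<circ> \<sigma>) \<in> {\<sigma>. \<sigma> permutes {1..n}} \<rightarrow>
      {\<pi>. \<pi> permutes {1..Suc n} \<and> \<pi> (Suc n) = v}"
  proof safe
    fix \<sigma> assume \<sigma>: "\<sigma> permutes {1..n}"
    show "bump n v \<circ> \<sigma> permutes {1..Suc n}"
      by (rule permutes_compose[OF permutes_subset[OF \<sigma>] b]) auto
    show "(bump n v \<circ> \<sigma>) (Suc n) = v"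
      using \<sigma> by (auto simp: bump_def permutes_def)
  qed
  show "(\<lambda>\<pi>. inv (bump n v) \<circ> \<pi>) \<in> {\<pi>. \<pi> permutes {1..Suc n} \<and> \<pi> (Suc n) = v} \<rightarrow>
      {\<sigma>. \<sigma> permutes {1..n}}"
  proof safe
    fix \<pi> assume \<pi>: "\<pi> permutes {1..Suc n}" and v: "v = \<pi> (Suc n)"
    have "inv (bump n v) \<circ> \<pi> permutes {1..Suc n}"
      by (rule permutes_compose[OF \<pi> permutes_inv[OF b]])
    moreover have "(inv (bump n v) \<circ> \<pi>) (Suc n) = Suc n"
      using permutes_inverses(2)[OF b, of "Suc n"] v by (simp add: bump_def)
    ultimately have "inv (bump n v) \<circ> \<pi> permutes {1..n}"
      by (elim permutes_superset) (metis DiffE atLeastAtMost_iff le_Suc_eq)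
    thus "inv (bump n (\<pi> (Suc n))) \<circ> \<pi> permutes {1..n}" using v by simp
  qed
qed (auto simp: fun_eq_iff permutes_inverses[OF bump_permutes[OF v]])

section \<open>Sums refined by last value and last step\<close>

definition perm_weight :: "'a \<Rightarrow> 'a \<Rightarrow> 'a \<Rightarrow> nat \<Rightarrow> (nat \<Rightarrow> nat) \<Rightarrow> 'a::comm_ring_1" where
  "perm_weight q y t n \<pi> = q ^ inv_num n \<pi> * y ^ lpk n \<pi> * t ^ des n \<pi>"

text \<open>The last value governs the new inversions and descents, and the last step decides
  whether a descent makes a left peak, so these two data admit a recurrence.\<close>

definition P_last :: "'a \<Rightarrow> 'a \<Rightarrow> 'a \<Rightarrow> bool \<Rightarrow> nat \<Rightarrow> nat \<Rightarrow> 'a::comm_ring_1" where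
  "P_last q y t b n v =
     (\<Sum>\<pi> | \<pi> permutes {1..n} \<and> \<pi> n = v \<and> last_up n \<pi> = b. perm_weight q y t n \<pi>)"

lemma finite_permutes_Collect: "finite {\<pi>. \<pi> permutes {1..n::nat} \<and> Q \<pi>}"
  by (rule finite_subset[OF _ finite_permutations[of "{1..n}"]]) auto

lemma sum_P_last:
  assumes "finite V"
  shows "(\<Sum>v\<in>V. P_last q y t b n v) =
    (\<Sum>\<pi> | \<pi> permutes {1..n} \<and> \<pi> n \<in> V \<and> last_up n \<pi> = b. perm_weight q y t n \<pi>)"
proof -
  have "(\<Sum>v\<in>V. P_last q y t b n v)
      = (\<Sum>v\<in>V. \<Sum>\<pi> | \<pi> \<in> {\<pi>. \<pi> permutes {1..n} \<and> \<pi> n \<in> V \<and> last_up n \<pi> = b} \<and> \<pi> n = v.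
          perm_weight q y t n \<pi>)"
    unfolding P_last_def by (intro sum.cong) auto
  thus ?thesis
    using sum.group[OF finite_permutes_Collect assms, of "\<lambda>\<pi>. \<pi> n" n
        "\<lambda>\<pi>. \<pi> n \<in> V \<and> last_up n \<pi> = b" "perm_weight q y t n"]
    by auto
qed

lemma P_last_1: "P_last q y t b 1 1 = (if b then 1 else 0)"
proof -
  have "inv_num 1 \<pi> = 0" for \<pi>
  proof -
    have *: "{(i, j). Suc 0 \<le> i \<and> i < j \<and> j \<le> Suc 0 \<and> \<pi> j < \<pi> i} = {}" by auto
    show ?thesis by (simp add: inv_num_def *)
  qed
  hence "perm_weight q y t 1 \<pi> = 1" for \<pi>
    by (simp add: perm_weight_def des_def lpk_def)
  moreover have "{\<pi>. \<pi> permutes {1..1::nat} \<and> \<pi> 1 = 1 \<and> last_up 1 \<pi> = b} = (if b then {id} else {})"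
    by (auto simp: last_up_def)
  ultimately show ?thesis by (simp add: P_last_def)
qed

lemma P_last_Suc_aux:
  assumes n: "1 \<le> n" and v: "v \<in> {1..Suc n}"
  shows "P_last q y t b (Suc n) v = (\<Sum>\<sigma> | \<sigma> permutes {1..n} \<and> (\<sigma> n < v) = b.
    q ^ (Suc n - v) * (if b then 1 else if last_up n \<sigma> then y * t else t) * perm_weight q y t n \<sigma>)"
proof -
  have "bij_betw (\<lambda>\<sigma>. bump n v \<circ> \<sigma>) {\<sigma> \<in> {\<sigma>. \<sigma> permutes {1..n}}. (\<sigma> n < v) = b}
    {\<pi> \<in> {\<pi>. \<pi> permutes {1..Suc n} \<and> \<pi> (Suc n) = v}. last_up (Suc n) \<pi> = b}"
    using last_up_bump_comp[OF n v]
    by (intro bij_betw_Collect[OF bij_betw_bump_comp[OF v]]) auto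
  hence bij: "bij_betw (\<lambda>\<sigma>. bump n v \<circ> \<sigma>) {\<sigma>. \<sigma> permutes {1..n} \<and> (\<sigma> n < v) = b}
    {\<pi>. \<pi> permutes {1..Suc n} \<and> \<pi> (Suc n) = v \<and> last_up (Suc n) \<pi> = b}"
    by (simp add: conj_assoc)
  show ?thesis
    unfolding P_last_def sum.reindex_bij_betw[OF bij, symmetric]
  proof (intro sum.cong refl, clarify)
    fix \<sigma> assume "\<sigma> permutes {1..n}" and b: "b = (\<sigma> n < v)"
    note * = n v this(1) refl
    show "perm_weight q y t (Suc n) (bump n v \<circ> \<sigma>) = q ^ (Suc n - v) *
        (if \<sigma> n < v then 1 else if last_up n \<sigma> then y * t else t) * perm_weight q y t n \<sigma>"
      unfolding perm_weight_def inv_num_bump_comp[OF *] lpk_bump_comp[OF *] des_bump_comp[OF *]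
      by (simp add: power_add mult_ac)
  qed
qed

lemma sum_Collect_split_bool:
  "finite A \<Longrightarrow> sum f A = sum f {x \<in> A. Q x = True} + sum f {x \<in> A. Q x = False}"
  by (subst sum.union_disjoint[symmetric]) (auto intro: sum.cong)

text \<open>Old last values below \<open>v\<close> lead to an ascent, those from \<open>v\<close> on
  to a descent; the previous step then decides on the factor \<open>y\<close>.\<close>

lemma P_last_Suc:
  assumes n: "1 \<le> n" and v: "v \<in> {1..Suc n}"
  shows "P_last q y t True (Suc n) v = q ^ (Suc n - v) *
      ((\<Sum>k=1..<v. P_last q y t True n k) + (\<Sum>k=1..<v. P_last q y t False n k))"
    and "P_last q y t False (Suc n) v = q ^ (Suc n - v) * t *
      (y * (\<Sum>k=v..n. P_last q y t True n k) + (\<Sum>k=v..n. P_last q y t False n k))"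
proof -
  have im: "\<sigma> n \<in> {1..n}" if "\<sigma> permutes {1..n}" for \<sigma>
    using n permutes_in_image[OF that] by simp
  have T: "{\<sigma> \<in> {\<sigma>. \<sigma> permutes {1..n} \<and> (\<sigma> n < v) = True}. last_up n \<sigma> = c}
      = {\<sigma>. \<sigma> permutes {1..n} \<and> \<sigma> n \<in> {1..<v} \<and> last_up n \<sigma> = c}" for c
    using im by fastforce
  have F: "{\<sigma> \<in> {\<sigma>. \<sigma> permutes {1..n} \<and> (\<sigma> n < v) = False}. last_up n \<sigma> = c}
      = {\<sigma>. \<sigma> permutes {1..n} \<and> \<sigma> n \<in> {v..n} \<and> last_up n \<sigma> = c}" for c
    using im by fastforce
  show "P_last q y t True (Suc n) v = q ^ (Suc n - v) *
      ((\<Sum>k=1..<v. P_last q y t True n k) + (\<Sum>k=1..<v. P_last q y t False n k))"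
    unfolding P_last_Suc_aux[OF assms] sum_P_last[OF finite_atLeastLessThan]
    by (subst sum_Collect_split_bool[of _ _ "last_up n", OF finite_permutes_Collect], unfold T)
      (simp add: sum_distrib_left distrib_left)
  show "P_last q y t False (Suc n) v = q ^ (Suc n - v) * t *
      (y * (\<Sum>k=v..n. P_last q y t True n k) + (\<Sum>k=v..n. P_last q y t False n k))"
    unfolding P_last_Suc_aux[OF assms] sum_P_last[OF finite_atLeastAtMost]
    by (subst sum_Collect_split_bool[of _ _ "last_up n", OF finite_permutes_Collect], unfold F)
      (simp add: sum_distrib_left distrib_left mult_ac)
qed

lemma P_inv_lpk_des_eq_sum_P_last:
  assumes "1 \<le> n"
  shows "P_inv_lpk_des n q y t = (\<Sum>v=1..n. P_last q y t True n v) + (\<Sum>v=1..n. P_last q y t False n v)"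
proof -
  have *: "{\<sigma> \<in> {\<sigma>. \<sigma> permutes {1..n}}. last_up n \<sigma> = c}
      = {\<sigma>. \<sigma> permutes {1..n} \<and> \<sigma> n \<in> {1..n} \<and> last_up n \<sigma> = c}" for c
    using assms permutes_in_image[of _ "{1..n}" n] by auto
  thus ?thesis
    unfolding P_inv_lpk_des_def sum_P_last[OF finite_atLeastAtMost] perm_weight_def[symmetric]
    by (subst sum_Collect_split_bool[of _ _ "last_up n"], simp add: finite_permutations)
      (simp only: *)
qed


section \<open>The generating function\<close>

text \<open>Since \<open>L\<close> has no constant term, the Cauchy product starts at its
  coefficient of index 1: a nonempty block is split off.\<close>

lemma fps_eq_multI:
  fixes F K L :: "'a::comm_ring_1 fps"
  assumes "fps_nth F 0 = 0" "fps_nth L 0 = 0"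
    and "\<And>n. fps_nth F (Suc n) = (\<Sum>m\<le>n. fps_nth K (n - m) * fps_nth L (Suc m))"
  shows "F = K * L"
proof (rule fps_ext)
  fix n show "fps_nth F n = fps_nth (K * L) n"
  proof (cases n)
    case (Suc k)
    have "fps_nth (L * K) (Suc k) = (\<Sum>m\<le>k. fps_nth L (Suc m) * fps_nth K (k - m))"
      unfolding fps_mult_nth atLeast0AtMost sum.atMost_Suc_shift by (simp add: assms)
    thus ?thesis using Suc assms(3)[of k] by (simp add: mult.commute)
  qed (simp add: assms)
qed

text \<open>Common source of both identities, with inverses given as elements. Only the product
  \<open>Y * T\<close> is prescribed because dividing by \<open>y + t\<close> is impossible in the
  power series case, where its constant term is 0.\<close>

lemma P_inv_lpk_des_fps:
  fixes q y t Y T r w z :: "'a::comm_ring_1"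
  assumes r: "r * (1 - t) = 1" and w: "w * (1 + y * t) = 1" and z: "z * (1 + y) = 1"
    and T: "(1 + y * t) * T = y + t" and YT: "(1 + y * t) ^ 2 * (Y * T) = (1 + y) ^ 2 * t"
    and \<phi>: "\<And>n. \<phi> n * qfact q n = 1"
  shows "Abs_fps (\<lambda>n. ((1 + y * t) * r) ^ n * P_inv_lpk_des n q Y T * \<phi> n)
      * (1 - fps_const t * Abs_fps (\<lambda>n. y ^ n * (q ^ (n choose 2) * \<phi> n)) * Abs_fps \<phi>)
    = fps_const (1 - t) * Abs_fps \<phi>"
proof -
  \<comment> \<open>\<open>s\<close> is the weight of an ascent. Below, \<open>i\<close> counts last
    values from 0; \<open>a\<close> collects words ending upwards, \<open>b\<close> those ending
    downwards.\<close>
  define s where "s = (1 + y * t) * r"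
  define a where "a n i = P_last q Y T True n (Suc i)" for n i
  define b where "b n i = P_last q Y T False n (Suc i)" for n i
  define u where "u n i = s ^ n * (w * a n i + z * b n i)" for n i
  define p where "p n i = s ^ n * y * (t * w * a n i + z * b n i)" for n i
  \<comment> \<open>\<open>u\<close> and \<open>p\<close> are the automaton components for increasing and decreasing blocks: a word ending
    in an ascent contributes along \<open>w (1, y t)\<close>, one ending in a descent along \<open>z (1, y)\<close>.\<close>
  define U where "U n = (\<Sum>i<n. u n i)" for n
  define V where "V n = (\<Sum>i<n. p n i)" for n
  define \<delta> :: "nat \<Rightarrow> 'a" where "\<delta> n = (if n = 0 then 1 else 0)" for n

  \<comment> \<open>Normalized weights of an ascent (\<open>sw\<close>), a further descent
    (\<open>sT\<close>) and the first descent of a run (\<open>sYT\<close>).\<close>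
  have "s * w = r * (w * (1 + y * t))" unfolding s_def by (simp only: mult_ac)
  hence sw: "s * w = r" by (simp add: w)
  have sT: "s * (z * T) = r * z * (y + t)" unfolding s_def T[symmetric] by (simp only: mult_ac)
  have sYT: "s * (z * (T * Y)) = r * w * (1 + y) * t"
  proof -
    have "s * (z * (T * Y)) = s * z * (Y * T) * (w * (1 + y * t)) * (z * (1 + y))"
      unfolding w z by (simp add: mult_ac)
    also have "\<dots> = r * w * z * ((1 + y * t) ^ 2 * (Y * T)) * (z * (1 + y))"
      unfolding s_def power2_eq_square by (simp only: mult_ac)
    also have "\<dots> = r * w * (1 + y) * t * (z * (1 + y)) * (z * (1 + y))"
      unfolding YT unfolding power2_eq_square by (simp only: mult_ac)
    finally show ?thesis by (simp add: z)
  qed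

  have r': "r = 1 + r * t" using r by (simp add: algebra_simps)
  have w': "w + w * y * t = 1" and z': "z + z * y = 1"
    using w z by (simp_all add: algebra_simps)
  \<comment> \<open>All follow from \<open>r'\<close>, \<open>w'\<close> and \<open>z'\<close>. They
    split each transition into opening a new block (terms with \<open>r\<close>) and continuing the
    current one.\<close>
  have e: "r * w * t + r * w * y * t + w = r" "r * z * t + r * z * y + z = r"
    "r * t * w + r * t * w * y * t = t * r" "r * t * z + r * t * y * z = t * r"
    "r * t * w + r * t * w * y * t + y * t * w = r * w * (1 + y) * t"
    "r * t * z + r * t * y * z + y * z = r * z * (y + t)"
  proof -
    have "r * w * t + r * w * y * t + w = (1 + r * t) * w + r * w * y * t"
      by (simp add: algebra_simps)
    also have "\<dots> = r * (w + w * y * t)"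
      unfolding r'[symmetric] by (simp add: algebra_simps)
    finally show "r * w * t + r * w * y * t + w = r" by (simp add: w')
    have "r * z * t + r * z * y + z = (1 + r * t) * z + r * z * y"
      by (simp add: algebra_simps)
    also have "\<dots> = r * (z + z * y)"
      unfolding r'[symmetric] by (simp add: algebra_simps)
    finally show "r * z * t + r * z * y + z = r" by (simp add: z')
    have "r * t * w + r * t * w * y * t = t * r * (w + w * y * t)"
      by (simp add: algebra_simps)
    thus "r * t * w + r * t * w * y * t = t * r" by (simp add: w')
    have "r * t * z + r * t * y * z = t * r * (z + z * y)"
      by (simp add: algebra_simps)
    thus "r * t * z + r * t * y * z = t * r" by (simp add: z')
    have "r * t * w + r * t * w * y * t + y * t * w = r * t * w + (1 + r * t) * (w * y * t)"
      by (simp add: algebra_simps)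
    thus "r * t * w + r * t * w * y * t + y * t * w = r * w * (1 + y) * t"
      unfolding r'[symmetric] by (simp add: algebra_simps)
    have "r * t * z + r * t * y * z + y * z = r * t * z + (1 + r * t) * (y * z)"
      by (simp add: algebra_simps)
    thus "r * t * z + r * t * y * z + y * z = r * z * (y + t)"
      unfolding r'[symmetric] by (simp add: algebra_simps)
  qed

  \<comment> \<open>With \<open>j\<close> one less than the last value, the number of new inversions
    becomes \<open>n - j\<close>.\<close>
  have a_Suc: "a (Suc n) j = q ^ (n - j) * ((\<Sum>i<j. a n i) + (\<Sum>i<j. b n i))"
    and b_Suc: "b (Suc n) j = q ^ (n - j) * T * (Y * (\<Sum>i=j..<n. a n i) + (\<Sum>i=j..<n. b n i))"
    if "1 \<le> n" "j \<le> n" for n j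
    using P_last_Suc[of n "Suc j" q Y T] that
    unfolding a_def b_def One_nat_def sum.shift_bounds_Suc_ivl
      atLeastLessThanSuc_atLeastAtMost[symmetric]
    by (simp_all add: lessThan_atLeast0)
  have split: "(\<Sum>i<n. f i) = (\<Sum>i<j. f i) + (\<Sum>i=j..<n. f i)"
    if "j \<le> n" for f :: "nat \<Rightarrow> 'a" and n j
    using that by (simp add: lessThan_atLeast0 sum.atLeastLessThan_concat)
  have U_eq: "U n = s ^ n * (w * (\<Sum>i<n. a n i) + z * (\<Sum>i<n. b n i))"
    and V_eq: "V n = s ^ n * y * (t * w * (\<Sum>i<n. a n i) + z * (\<Sum>i<n. b n i))" for n
    unfolding U_def V_def u_def p_def by (simp_all add: sum_distrib_left sum.distrib distrib_left mult_ac)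
  have a_1: "a (Suc 0) 0 = 1" and b_1: "b (Suc 0) 0 = 0"
    using P_last_1[of q Y T] by (simp_all add: a_def b_def)

  \<comment> \<open>A letter opens an increasing block or continues one. Opening costs at least one
    \<open>t\<close> after an increasing block, but none after a decreasing block or at the start;
    \<open>r\<close>, the geometric series in \<open>t\<close>, covers skipped empty blocks.\<close>
  have u_Suc: "u (Suc n) j = q ^ (n - j) * (r * (t * U n + V n + \<delta> n) + (\<Sum>i<j. u n i))"
    if "j \<le> n" for n j
  proof (cases "n = 0")
    case True
    thus ?thesis using that sw by (simp add: u_def a_1 b_1 U_def V_def \<delta>_def)
  next
    case False
    define a1 a2 b1 b2 where "a1 = (\<Sum>i<j. a n i)" and "a2 = (\<Sum>i=j..<n. a n i)"
      and "b1 = (\<Sum>i<j. b n i)" and "b2 = (\<Sum>i=j..<n. b n i)"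
    have "u (Suc n) j = q ^ (n - j) * s ^ n *
        (s * w * (a1 + b1) + s * (z * (T * Y)) * a2 + s * (z * T) * b2)"
      using False that unfolding u_def a1_def a2_def b1_def b2_def
      by (simp add: a_Suc b_Suc algebra_simps)
    also have "\<dots> = q ^ (n - j) * s ^ n *
        (r * (a1 + b1) + r * w * (1 + y) * t * a2 + r * z * (y + t) * b2)"
      unfolding sw sT sYT ..
    also have "r * (a1 + b1) + r * w * (1 + y) * t * a2 + r * z * (y + t) * b2
        = r * (t * (w * (a1 + a2) + z * (b1 + b2)) + y * (t * w * (a1 + a2) + z * (b1 + b2)))
          + (w * a1 + z * b1)"
    \<comment> \<open>Only \<open>a1\<close> and \<open>b1\<close>, which belong to an appended
      ascent, can continue an increasing block; \<open>a2\<close> and \<open>b2\<close> match the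
      opening terms alone.\<close>
    proof -
      have "r * a1 = (r * w * t + r * w * y * t + w) * a1"
        and "r * b1 = (r * z * t + r * z * y + z) * b1"
        unfolding e(1,2) by simp_all
      thus ?thesis by (simp add: algebra_simps)
    qed
    finally show ?thesis
      using False unfolding U_eq V_eq split[OF that] a1_def a2_def b1_def b2_def
      by (simp add: \<delta>_def u_def sum_distrib_left sum.distrib algebra_simps)
  qed

  \<comment> \<open>Opening a decreasing block always costs a \<open>t\<close>, besides the letter's
    own \<open>y\<close>.\<close>
  have p_Suc: "p (Suc n) j = q ^ (n - j) * (r * t * y * (U n + V n + \<delta> n) + y * (\<Sum>i=j..<n. p n i))"
    if "j \<le> n" for n j
  proof (cases "n = 0")
    case True
    thus ?thesis using that by (simp add: p_def a_1 b_1 U_def V_def \<delta>_def sw[symmetric] mult_ac)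
  next
    case False
    define a1 a2 b1 b2 where "a1 = (\<Sum>i<j. a n i)" and "a2 = (\<Sum>i=j..<n. a n i)"
      and "b1 = (\<Sum>i<j. b n i)" and "b2 = (\<Sum>i=j..<n. b n i)"
    have "p (Suc n) j = q ^ (n - j) * s ^ n * y *
        (t * (s * w) * (a1 + b1) + s * (z * (T * Y)) * a2 + s * (z * T) * b2)"
      using False that unfolding p_def a1_def a2_def b1_def b2_def
      by (simp add: a_Suc b_Suc algebra_simps)
    also have "\<dots> = q ^ (n - j) * s ^ n * y *
        (t * r * (a1 + b1) + r * w * (1 + y) * t * a2 + r * z * (y + t) * b2)"
      unfolding sw sT sYT ..
    also have "t * r * (a1 + b1) + r * w * (1 + y) * t * a2 + r * z * (y + t) * b2
        = r * t * (w * (a1 + a2) + z * (b1 + b2) + y * (t * w * (a1 + a2) + z * (b1 + b2)))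
          + y * (t * w * a2 + z * b2)"
    \<comment> \<open>Now the roles are exchanged: \<open>a2\<close> and \<open>b2\<close> include
      the continuation of a decreasing block.\<close>
    proof -
      have "t * r * a1 = (r * t * w + r * t * w * y * t) * a1"
        and "t * r * b1 = (r * t * z + r * t * y * z) * b1"
        unfolding e(3,4) by simp_all
      moreover have "r * w * (1 + y) * t * a2 = (r * t * w + r * t * w * y * t + y * t * w) * a2"
        and "r * z * (y + t) * b2 = (r * t * z + r * t * y * z + y * z) * b2"
        unfolding e(5,6) by simp_all
      ultimately show ?thesis by (simp add: algebra_simps)
    qed
    finally show ?thesis
      using False unfolding U_eq V_eq split[OF that] a1_def a2_def b1_def b2_def
      by (simp add: \<delta>_def p_def sum_distrib_left sum.distrib algebra_simps)
  qed

  have U_Suc: "U (Suc n) = (\<Sum>m\<le>n. r * (t * U (n - m) + V (n - m) + \<delta> (n - m)) *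
      qbinom q (Suc n) (Suc m))" for n
    unfolding U_def[of "Suc n"]
    by (rule sum_increasing_recurrence[where c = "\<lambda>n. r * (t * U n + V n + \<delta> n)"]) (rule u_Suc)
  have V_Suc: "V (Suc n) = (\<Sum>m\<le>n. r * t * y * (U (n - m) + V (n - m) + \<delta> (n - m)) *
      (y ^ m * q ^ (Suc m choose 2) * qbinom q (Suc n) (Suc m)))" for n
    unfolding V_def[of "Suc n"]
    by (rule sum_decreasing_recurrence[where d = "\<lambda>n. r * t * y * (U n + V n + \<delta> n)"]) (rule p_Suc)

  define Uf where "Uf = Abs_fps (\<lambda>n. U n * \<phi> n)"
  define Vf where "Vf = Abs_fps (\<lambda>n. V n * \<phi> n)"
  define H where "H = Abs_fps \<phi>"
  define E where "E = Abs_fps (\<lambda>n. y ^ n * (q ^ (n choose 2) * \<phi> n))"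
  define G where "G = Abs_fps (\<lambda>n. s ^ n * P_inv_lpk_des n q Y T * \<phi> n)"
  have \<phi>0: "\<phi> 0 = 1" using \<phi>[of 0] by simp
  have \<delta>: "\<delta> n * \<phi> n = fps_nth 1 n" for n by (simp add: \<delta>_def \<phi>0)
  have U0: "U 0 = 0" "V 0 = 0" by (simp_all add: U_def V_def)
  note conv = qbinom_Suc_Suc_inverse_qfact[of \<phi> q, OF \<phi>]
  \<comment> \<open>By \<open>w'\<close> and \<open>z'\<close> the two components of a state vector
    add up to the full weight of the word; the constant 1 is the empty word.\<close>
  have G: "G = Uf + Vf + 1"
  proof (rule fps_ext)
    fix n
    have "s ^ n * P_inv_lpk_des n q Y T = U n + V n + \<delta> n"
    proof (cases n)
      case 0
      thus ?thesis by (simp add: P_inv_lpk_des_0 U0 \<delta>_def)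
    next
      case (Suc k)
      have P: "P_inv_lpk_des n q Y T = (\<Sum>i<n. a n i) + (\<Sum>i<n. b n i)"
        using Suc unfolding a_def b_def
        by (simp only: P_inv_lpk_des_eq_sum_P_last One_nat_def sum.atLeast1_atMost_eq le_add1
            Suc_le_mono le0)
      have "U n + V n = s ^ n * ((w + w * y * t) * (\<Sum>i<n. a n i) + (z + z * y) * (\<Sum>i<n. b n i))"
        unfolding U_eq V_eq by (simp add: algebra_simps)
      thus ?thesis unfolding P w' z' using Suc by (simp add: \<delta>_def)
    qed
    thus "fps_nth G n = fps_nth (Uf + Vf + 1) n"
      by (simp add: G_def Uf_def Vf_def distrib_right \<delta> del: fps_one_nth)
  qed
  have coeff_U: "fps_nth (fps_const r * (fps_const t * Uf + Vf + 1)) n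
      = r * (t * U n + V n + \<delta> n) * \<phi> n"
    and coeff_V: "fps_nth (fps_const (r * t) * (Uf + Vf + 1)) n
      = r * t * (U n + V n + \<delta> n) * \<phi> n" for n
    by (simp_all only: fps_mult_left_const_nth fps_add_nth \<delta>[symmetric] Uf_def Vf_def fps_nth_Abs_fps)
      (simp_all only: algebra_simps)
  have coeff_H: "fps_nth (H - 1) (Suc m) = \<phi> (Suc m)"
    and coeff_E: "fps_nth (E - 1) (Suc m) = y ^ Suc m * (q ^ (Suc m choose 2) * \<phi> (Suc m))" for m
    by (simp_all add: H_def E_def del: power_Suc binomial_Suc_Suc)
  \<comment> \<open>\<open>H - 1\<close> generates the nonempty last increasing block.\<close>
  have "Uf = fps_const r * (fps_const t * Uf + Vf + 1) * (H - 1)"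
  proof (rule fps_eq_multI)
    fix n
    have "fps_nth Uf (Suc n) = (\<Sum>m\<le>n. r * (t * U (n - m) + V (n - m) + \<delta> (n - m)) *
        (\<phi> (Suc n) * qbinom q (Suc n) (Suc m)))"
      unfolding Uf_def fps_nth_Abs_fps U_Suc by (simp add: sum_distrib_left sum_distrib_right mult_ac del: qbinom.simps)
    also have "\<dots> = (\<Sum>m\<le>n. r * (t * U (n - m) + V (n - m) + \<delta> (n - m)) *
        (\<phi> (Suc m) * \<phi> (n - m)))"
      by (intro sum.cong refl) (simp only: conv atMost_iff)
    also have "\<dots> = (\<Sum>m\<le>n. fps_nth (fps_const r * (fps_const t * Uf + Vf + 1)) (n - m)
        * fps_nth (H - 1) (Suc m))"
      unfolding coeff_U coeff_H by (simp only: mult_ac)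
    finally show "fps_nth Uf (Suc n) = \<dots>" .
  qed (simp_all add: Uf_def U0 H_def \<phi>0)
  \<comment> \<open>Likewise for decreasing blocks; the \<open>y\<close> of the opening letter
    completes \<open>y ^ m\<close> to \<open>y ^ Suc m\<close>.\<close>
  moreover have "Vf = fps_const (r * t) * (Uf + Vf + 1) * (E - 1)"
  proof (rule fps_eq_multI)
    fix n
    have "fps_nth Vf (Suc n) = (\<Sum>m\<le>n. r * t * y * (U (n - m) + V (n - m) + \<delta> (n - m)) *
        (y ^ m * q ^ (Suc m choose 2)) * (\<phi> (Suc n) * qbinom q (Suc n) (Suc m)))"
      unfolding Vf_def fps_nth_Abs_fps V_Suc by (simp add: sum_distrib_left sum_distrib_right mult_ac del: qbinom.simps binomial_Suc_Suc)
    also have "\<dots> = (\<Sum>m\<le>n. r * t * y * (U (n - m) + V (n - m) + \<delta> (n - m)) *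
        (y ^ m * q ^ (Suc m choose 2)) * (\<phi> (Suc m) * \<phi> (n - m)))"
      by (intro sum.cong refl) (simp only: conv atMost_iff)
    also have "\<dots> = (\<Sum>m\<le>n. fps_nth (fps_const (r * t) * (Uf + Vf + 1)) (n - m)
        * fps_nth (E - 1) (Suc m))"
      unfolding coeff_V coeff_E power_Suc by (simp only: mult_ac)
    finally show "fps_nth Vf (Suc n) = \<dots>" .
  qed (simp_all add: Vf_def U0 E_def \<phi>0 numeral_2_eq_2)
  moreover define R \<tau> where "R = fps_const r" and "\<tau> = fps_const t"
  ultimately have Uf: "Uf = R * (\<tau> * Uf + Vf + 1) * (H - 1)"
    and Vf: "Vf = R * \<tau> * G * (E - 1)"
    by (simp_all add: G)
  have R: "R * (1 - \<tau>) = 1"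
    using r by (simp add: R_def \<tau>_def flip: fps_const_1_eq_1)
  have "(1 - \<tau>) * Uf = (R * (1 - \<tau>)) * ((\<tau> * Uf + Vf + 1) * (H - 1))"
    by (subst Uf) (simp only: mult_ac)
  \<comment> \<open>The last bracket vanishes by the equation for \<open>Uf\<close>; the equation
    for \<open>Vf\<close> then leaves \<open>G\<close> alone.\<close>
  moreover have "G = \<tau> * G * H + ((1 - \<tau>) * Vf) * H + (1 - \<tau>) * H
      + ((1 - \<tau>) * Uf - (\<tau> * Uf + Vf + 1) * (H - 1))"
    unfolding G by (simp add: algebra_simps)
  ultimately have U': "G = \<tau> * G * H + ((1 - \<tau>) * Vf) * H + (1 - \<tau>) * H"
    unfolding R by simp
  have "(1 - \<tau>) * Vf = (R * (1 - \<tau>)) * (\<tau> * G * (E - 1))"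
    by (subst Vf) (simp only: mult_ac)
  hence "G = \<tau> * G * H + (\<tau> * G * (E - 1)) * H + (1 - \<tau>) * H"
    using U' by (simp add: R)
  hence "G * (1 - \<tau> * E * H) = (1 - \<tau>) * H"
    by (simp add: algebra_simps)
  thus ?thesis
    by (simp add: G_def E_def H_def s_def \<tau>_def flip: fps_const_sub)
qed


section \<open>The two coefficient rings\<close>

lemma fps_mult_inverse_eq_1:
  fixes f :: "'a::{comm_ring_1,inverse} fps"
  assumes "fps_nth f 0 * inverse (fps_nth f 0) = 1"
  shows "f * inverse f = 1"
  using fps_right_inverse[OF assms] by (simp add: fps_inverse_def)

text \<open>Coefficients may themselves be power series, so invertibility of \<open>g\<close> is
  read off from its constant coefficient.\<close>

lemma fps_divide_eqI:
  fixes f g h :: "'a::{comm_ring_1,inverse} fps"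
  assumes "fps_nth g 0 * inverse (fps_nth g 0) = 1" and "h * g = f"
  shows "f / g = h"
proof -
  have "fps_nth g 0 \<noteq> 0" using assms(1) by force
  hence "f / g = h * (g * inverse g)"
    by (simp add: fps_divide_unit assms(2)[symmetric] mult.assoc)
  thus ?thesis by (simp add: fps_mult_inverse_eq_1[OF assms(1)])
qed

section \<open>Nonvanishing of q-factorials and denominators\<close>

lemma qfact_hom:
  fixes h :: "'a::comm_ring_1 \<Rightarrow> 'b::comm_ring_1"
  assumes h: "h 1 = 1" "\<And>x y. h (x + y) = h x + h y" "\<And>x y. h (x * y) = h x * h y"
  shows "qfact (h x) n = h (qfact x n)"
proof -
  have "h 0 = 0" using h(2)[of 0 0] by simp
  moreover have "h (x ^ i) = h x ^ i" for i by (induction i) (simp_all add: h)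
  ultimately have "(\<Sum>i<k. h x ^ i) = h (\<Sum>i<k. x ^ i)" for k
    by (induction k) (simp_all add: h)
  thus ?thesis by (induction n) (simp_all add: qfact_Suc h del: sum.lessThan_Suc)
qed

text \<open>Evaluation at 1 turns the q-factorial into a nonzero rational number, the ordinary
  factorial.\<close>

lemma qfact_indet_q: "qfact indet_q n \<noteq> 0"
proof -
  have "poly (qfact [:0, 1:] n) 1 = qfact (1 :: rat) n"
    using qfact_hom[of "\<lambda>p. poly p (1 :: rat)" "[:0, 1:]" n] by simp
  also have "qfact (1 :: rat) n \<noteq> 0"
    by (induction n) (simp_all add: qfact_Suc add_eq_0_iff del: sum.lessThan_Suc)
  finally have "qfact [:0, 1 :: rat:] n \<noteq> 0" by auto
  moreover have "qfact indet_q n = to_fract (qfact [:0, 1:] n)"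
    unfolding indet_q_def by (rule qfact_hom) simp_all
  ultimately show ?thesis by simp
qed

lemma qfact_to_fract_const: "qfact (to_fract [:x:]) n = to_fract [:qfact x n:]"
  by (rule qfact_hom) (simp_all flip: to_fract_add to_fract_mult one_pCons)

lemma qfact_qF: "qfact qF n \<noteq> 0"
  by (simp add: qF_def qfact_to_fract_const qfact_indet_q)

lemma qfact_qS: "qfact qS n = fps_const (to_fract [:qfact indet_q n:])"
  using qfact_hom[of fps_const "to_fract [:indet_q:]" n]
  by (simp add: qS_def qfact_to_fract_const)

lemma yF_tF_nonzero:
  "1 - tF \<noteq> 0" "1 + yF \<noteq> 0" "yF + tF \<noteq> 0" "1 + yF * tF \<noteq> 0"
proof -
  have "1 - tF = to_fract [:1, -1:]" "yF + tF = to_fract [:indet_y, 1:]"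
    "1 + yF * tF = to_fract [:1, indet_y:]" "1 + yF = to_fract [:1 + indet_y:]"
    by (simp_all add: tF_def yF_def one_pCons flip: to_fract_1 to_fract_add to_fract_diff to_fract_mult
      del: to_fract_1)
  moreover have "1 + indet_y = to_fract [:1, 1:]"
    by (simp add: indet_y_def one_pCons flip: to_fract_1 to_fract_add del: to_fract_1)
  hence "1 + indet_y \<noteq> 0" by simp
  ultimately show "1 - tF \<noteq> 0" "1 + yF \<noteq> 0" "yF + tF \<noteq> 0" "1 + yF * tF \<noteq> 0"
    by simp_all
qed

lemma uS_0: "fps_nth uS 0 = 0" and vS_0: "fps_nth vS 0 = 0"
  by (simp_all add: uS_exact(1) vS_exact(1) tS_def)

text \<open>\<open>u\<close> and \<open>v\<close> invert the change of variables of the first identity.\<close>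

lemma uS_vS_relations:
  "(1 + uS * vS) * tS = uS + vS"
  "(1 + uS * vS) ^ 2 * (yS * tS) = (1 + uS) ^ 2 * vS"
proof -
  \<comment> \<open>The denominators of \<open>uS\<close> and \<open>vS\<close>; after
    multiplication by them only polynomials in \<open>sqrtS\<close> remain.\<close>
  define c d where "c = 2 * (1 - yS) * tS" and "d = 2 * yS * tS"
  have "1 - yS \<noteq> 0" "yS \<noteq> 0" "(2 :: Qqy fps) \<noteq> 0" "tS \<noteq> 0"
    using indet_y_neq by (simp_all add: yS_def tS_def flip: fps_const_1_eq_1)
  hence nz: "c \<noteq> 0" "d \<noteq> 0" by (simp_all add: c_def d_def)
  have u: "uS * c = 1 + tS ^ 2 - 2 * yS * tS - (1 - tS) * sqrtS"
    and v: "vS * d = (1 + tS) ^ 2 - 2 * yS * tS - (1 + tS) * sqrtS"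
    unfolding c_def d_def by (rule uS_exact vS_exact)+
  have "((1 + uS * vS) * tS) * (c * d) - (uS + vS) * (c * d)
      = tS * (c * d + (uS * c) * (vS * d)) - (uS * c) * d - (vS * d) * c"
    by (simp add: algebra_simps)
  also have "\<dots> = tS * (1 - tS ^ 2) * (sqrtS ^ 2 - ((1 + tS) ^ 2 - 4 * yS * tS))"
    unfolding u v unfolding c_def d_def by algebra
  also have "\<dots> = 0" by (simp add: sqrtS(2))
  finally show t: "(1 + uS * vS) * tS = uS + vS" using nz by simp
  have v1: "fps_nth (1 + vS) 0 \<noteq> 0" by (simp add: vS_0)
  \<comment> \<open>First a relation for \<open>vS\<close> alone; since \<open>d\<close> is twice
    \<open>yS * tS\<close>, the factor \<open>2 * d\<close> produces a square.\<close>
  have "yS * tS * (1 + vS) ^ 2 * (2 * d) = (d + vS * d) ^ 2"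
    unfolding d_def by algebra
  also have "\<dots> = (1 + tS) ^ 2 * ((1 + tS) ^ 2 - 2 * (1 + tS) * sqrtS + sqrtS ^ 2)"
    unfolding v unfolding d_def by algebra
  also have "\<dots> = (1 + tS) ^ 2 * (2 * (vS * d))"
    unfolding v sqrtS(2) by algebra
  finally have "yS * tS * (1 + vS) ^ 2 * (2 * d) = (1 + tS) ^ 2 * vS * (2 * d)"
    by (simp only: mult_ac)
  hence yt: "yS * tS * (1 + vS) ^ 2 = (1 + tS) ^ 2 * vS" using nz by simp
  \<comment> \<open>Adding \<open>1 + uS * vS\<close> to the first relation factors the right-hand
    side, which brings \<open>uS\<close> into the relation for \<open>vS\<close>.\<close>
  have "(1 + uS * vS) * (1 + tS) = (1 + uS) * (1 + vS)"
    using t by (simp add: algebra_simps)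
  hence "((1 + uS * vS) ^ 2 * (yS * tS)) * (1 + vS) ^ 2 = ((1 + uS) * (1 + vS)) ^ 2 * vS"
    using yt by (metis (no_types, lifting) mult.assoc power_mult_distrib)
  hence "((1 + uS * vS) ^ 2 * (yS * tS)) * (1 + vS) ^ 2 = ((1 + uS) ^ 2 * vS) * (1 + vS) ^ 2"
    by (simp only: power_mult_distrib mult_ac)
  moreover have "1 + vS \<noteq> 0" using v1 by force
  ultimately show "(1 + uS * vS) ^ 2 * (yS * tS) = (1 + uS) ^ 2 * vS" by simp
qed

section \<open>The two identities over general coefficients\<close>

lemma P_inv_lpk_des_fps_field:
  fixes q y t :: "'a::field"
  assumes nz: "1 - t \<noteq> 0" "1 + y \<noteq> 0" "y + t \<noteq> 0" "1 + y * t \<noteq> 0"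
    and q: "\<And>n. qfact q n \<noteq> 0"
  shows "(fps_const (1 - t) * exp_q q) / (1 - fps_const t * at_cx (Exp_q q) y * exp_q q)
    = Abs_fps (\<lambda>n. ((1 + y * t) / (1 - t)) ^ n
        * P_inv_lpk_des n q ((1 + y) ^ 2 * t / ((y + t) * (1 + y * t))) ((y + t) / (1 + y * t))
        / qfact q n)"
    (is "?N / ?D = ?G")
proof (rule fps_divide_eqI)
  define T where "T = (y + t) / (1 + y * t)"
  define Y where "Y = (1 + y) ^ 2 * t / ((y + t) * (1 + y * t))"
  have T: "(1 + y * t) * T = y + t" and YT: "(1 + y * t) ^ 2 * (Y * T) = (1 + y) ^ 2 * t"
    using nz by (simp_all add: T_def Y_def power2_eq_square)
  have E: "Abs_fps (\<lambda>n. y ^ n * (q ^ (n choose 2) * (1 / qfact q n))) = at_cx (Exp_q q) y"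
    by (simp add: at_cx_def Exp_q_def fps_compose_linear)
  have "Abs_fps (\<lambda>n. ((1 + y * t) * (1 / (1 - t))) ^ n * P_inv_lpk_des n q Y T * (1 / qfact q n))
      * ?D = ?N"
    unfolding E[symmetric] exp_q_def
    by (rule P_inv_lpk_des_fps[OF _ _ _ T YT, of _ "1 / (1 + y * t)" "1 / (1 + y)"]) (use nz q in simp_all)
  thus "?G * ?D = ?N" by (simp add: Y_def T_def)
  show "fps_nth ?D 0 * inverse (fps_nth ?D 0) = 1"
    using nz by (simp add: at_cx_def exp_q_def Exp_q_def fps_compose_linear numeral_2_eq_2)
qed

text \<open>The two relations are the hypotheses of \<open>P_inv_lpk_des_fps\<close> at
  \<open>u\<close> and \<open>v\<close>, with \<open>y\<close> and \<open>t\<close> as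
  \<open>Y\<close> and \<open>T\<close>; rescaling \<open>x\<close> then removes the powers of
  \<open>(1 + u * v) / (1 - v)\<close>.\<close>

lemma P_inv_lpk_des_fps_inverse_substitution:
  fixes q y t u v :: "'a::field fps"
  assumes rel: "(1 + u * v) * t = u + v" "(1 + u * v) ^ 2 * (y * t) = (1 + u) ^ 2 * v"
    and u: "fps_nth u 0 = 0" and v: "fps_nth v 0 = 0"
    and q: "\<And>n. fps_nth (qfact q n) 0 \<noteq> 0"
  shows "Abs_fps (\<lambda>n. P_inv_lpk_des n q y t / qfact q n)
     = (fps_const (1 - v) * at_cx (exp_q q) ((1 - v) / (1 + u * v)))
       / (1 - fps_const v * at_cx (Exp_q q) (u * (1 - v) / (1 + u * v))
                           * at_cx (exp_q q) ((1 - v) / (1 + u * v)))"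
proof -
  let ?\<phi> = "\<lambda>n. inverse (qfact q n)"
  let ?r = "inverse (1 - v)" and ?w = "inverse (1 + u * v)" and ?z = "inverse (1 + u)"
  let ?c = "(1 - v) / (1 + u * v)"
  let ?D = "1 - fps_const v * at_cx (Exp_q q) (u * (1 - v) / (1 + u * v))
              * at_cx (exp_q q) ?c"
  have r: "?r * (1 - v) = 1" and w: "?w * (1 + u * v) = 1" and z: "?z * (1 + u) = 1"
    by (intro inverse_mult_eq_1; simp add: u v)+
  have div_qfact: "a / qfact q n = a * ?\<phi> n" for a n
    using q by (simp add: fps_divide_unit)
  have \<phi>: "?\<phi> n * qfact q n = 1" for n
    using q by (simp add: inverse_mult_eq_1)
  have exp_q: "exp_q q = Abs_fps ?\<phi>" by (simp add: exp_q_def div_qfact)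
  have \<phi>0: "?\<phi> 0 = 1" using \<phi>[of 0] by simp
  have c: "?c = (1 - v) * ?w" and uc: "u * (1 - v) / (1 + u * v) = u * ?c"
    by (simp_all add: fps_divide_unit u mult.assoc)
  have "?c * ((1 + u * v) * ?r) = (?r * (1 - v)) * (?w * (1 + u * v))"
    unfolding c by (simp only: mult_ac)
  hence cs: "?c * ((1 + u * v) * ?r) = 1" by (simp add: r w)
  let ?X = "fps_const ?c * fps_X"
  define G where "G = Abs_fps (\<lambda>n. ((1 + u * v) * ?r) ^ n * P_inv_lpk_des n q y t * ?\<phi> n)"
  define E where "E = Abs_fps (\<lambda>n. u ^ n * (q ^ (n choose 2) * ?\<phi> n))"
  have "G * (1 - fps_const v * E * exp_q q) = fps_const (1 - v) * exp_q q"
    unfolding G_def E_def exp_q using r w z \<phi>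
    by (intro P_inv_lpk_des_fps) (simp_all add: rel)
  hence "(G * (1 - fps_const v * E * exp_q q)) oo ?X = (fps_const (1 - v) * exp_q q) oo ?X"
    by simp
  moreover have "G oo ?X = Abs_fps (\<lambda>n. P_inv_lpk_des n q y t * ?\<phi> n)"
  proof -
    have "?c ^ n * (((1 + u * v) * ?r) ^ n * a * b) = a * b" for n a b
      using arg_cong[OF cs, of "\<lambda>x. x ^ n * a * b"]
      by (simp only: power_mult_distrib[of ?c] mult.assoc power_one mult_1_left)
    thus ?thesis unfolding G_def fps_compose_linear fps_nth_Abs_fps by (simp only:)
  qed
  moreover have "E oo ?X = at_cx (Exp_q q) (u * ?c)"
    unfolding E_def at_cx_def Exp_q_def fps_compose_linear fps_nth_Abs_fps
      div_qfact power_mult_distrib by (simp only: mult_ac)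
  ultimately have "Abs_fps (\<lambda>n. P_inv_lpk_des n q y t * ?\<phi> n) * ?D
      = fps_const (1 - v) * at_cx (exp_q q) ?c"
    unfolding uc by (simp add: fps_compose_mult_distrib fps_compose_sub_distrib at_cx_def)
  moreover have "fps_nth ?D 0 * inverse (fps_nth ?D 0) = 1"
    using inverse_mult_eq_1'[of "1 - v"]
    by (simp add: at_cx_def exp_q_def Exp_q_def fps_compose_linear numeral_2_eq_2 div_qfact \<phi>0 v)
  ultimately show "Abs_fps (\<lambda>n. P_inv_lpk_des n q y t / qfact q n)
      = fps_const (1 - v) * at_cx (exp_q q) ?c / ?D"
    unfolding div_qfact by (intro fps_divide_eqI[symmetric])
qed

theorem theorem4p8:
  shows
    "(fps_const (1 - tF) * exp_q qF) / (1 - fps_const tF * at_cx (Exp_q qF) yF * exp_q qF)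
     = Abs_fps (\<lambda>n. ((1 + yF * tF) / (1 - tF)) ^ n
         * P_inv_lpk_des n qF ((1 + yF) ^ 2 * tF / ((yF + tF) * (1 + yF * tF)))
                              ((yF + tF) / (1 + yF * tF))
         / qfact qF n)
   \<and>
     Abs_fps (\<lambda>n. P_inv_lpk_des n qS yS tS / qfact qS n)
     = (fps_const (1 - vS) * at_cx (exp_q qS) ((1 - vS) / (1 + uS * vS)))
       / (1 - fps_const vS * at_cx (Exp_q qS) (uS * (1 - vS) / (1 + uS * vS))
                           * at_cx (exp_q qS) ((1 - vS) / (1 + uS * vS)))"
proof
  show "(fps_const (1 - tF) * exp_q qF) / (1 - fps_const tF * at_cx (Exp_q qF) yF * exp_q qF)
     = Abs_fps (\<lambda>n. ((1 + yF * tF) / (1 - tF)) ^ n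
         * P_inv_lpk_des n qF ((1 + yF) ^ 2 * tF / ((yF + tF) * (1 + yF * tF)))
                              ((yF + tF) / (1 + yF * tF))
         / qfact qF n)"
    using yF_tF_nonzero qfact_qF by (rule P_inv_lpk_des_fps_field)
next
  show "Abs_fps (\<lambda>n. P_inv_lpk_des n qS yS tS / qfact qS n)
     = (fps_const (1 - vS) * at_cx (exp_q qS) ((1 - vS) / (1 + uS * vS)))
       / (1 - fps_const vS * at_cx (Exp_q qS) (uS * (1 - vS) / (1 + uS * vS))
                           * at_cx (exp_q qS) ((1 - vS) / (1 + uS * vS)))"
    by (intro P_inv_lpk_des_fps_inverse_substitution uS_vS_relations uS_0 vS_0)
      (simp add: qfact_qS qfact_indet_q)
qed

end
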